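(* Let $n\ge1$ and let $v$ be a non-Archimedean valuation on a field $\mathbb F$. Then every $c_v$-rainbow set of points of $\mathrm{PG}(n-1,\mathbb F)$ is independent (i.e. any choice of representing vectors is linearly independent in $\mathbb F^n$).
   Context: A non-Archimedean valuation on $\mathbb F$ is a function $v:\mathbb F\to\mathbb R\cup\{\infty\}$ with $v^{-1}(\infty)=\{0\}$, $v(ab)=v(a)+v(b)$ and $v(a+b)\ge\min(v(a),v(b))$ for all $a,b$. $\mathrm{PG}(n-1,\mathbb F)$ has as points the one-dimensional subspaces $[u]$ of $\mathbb F^n$ ($u\ne0$). The colouring $c_v$ assigns to $[u]$, $u=(u_1,\dots,u_n)$, the smallest index $s$ with $v(u_s)=\min_iv(u_i)$ (this is independent of the representative $u$). A set of points is $c_v$-rainbow if $c_v$ is injective on it. *)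

theory Defs
  imports "HOL-Analysis.Analysis"
begin

text \<open>
  The index type of \<open>'a ^ 'n\<close> is an arbitrary nonempty finite linear order,
  i.e. \<open>{1, \<dots>, n}\<close> with \<open>n = CARD('n) \<ge> 1\<close>.
\<close>

definition nonarch_valuation :: "('a::field \<Rightarrow> ereal) \<Rightarrow> bool" where
  "nonarch_valuation v \<longleftrightarrow>
     (\<forall>a. v a \<noteq> -\<infinity>) \<and>
     v -` {\<infinity>} = {0} \<and>
     (\<forall>a b. v (a * b) = v a + v b) \<and>
     (\<forall>a b. v (a + b) \<ge> min (v a) (v b))"

definition pg_points :: "(('a::field) ^ 'n) set set" where
  "pg_points = {P. vec.subspace P \<and> vec.dim P = 1}"

definition vec_colour :: "('a::field \<Rightarrow> ereal) \<Rightarrow> 'a ^ ('n::{finite,linorder}) \<Rightarrow> 'n" where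
  "vec_colour v u = (LEAST s. v (u $ s) = Min (range (\<lambda>i. v (u $ i))))"

text \<open>The description is well defined by lemma \<open>point_colour_eq\<close> below.\<close>

definition point_colour :: "('a::field \<Rightarrow> ereal) \<Rightarrow> ('a ^ ('n::{finite,linorder})) set \<Rightarrow> 'n" where
  "point_colour v P = (THE s. \<forall>u\<in>P. u \<noteq> 0 \<longrightarrow> vec_colour v u = s)"

definition rainbow :: "('a::field \<Rightarrow> ereal) \<Rightarrow> ('a ^ ('n::{finite,linorder})) set set \<Rightarrow> bool" where
  "rainbow v S \<longleftrightarrow> inj_on (point_colour v) S"

text \<open>
  \<open>inj_on r S\<close> together with independence of the set \<open>r ` S\<close> says that the
  family \<open>r\<close> of representatives is linearly independent.
\<close>

definition independent_points :: "(('a::field) ^ 'n) set set \<Rightarrow> bool" where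
  "independent_points S \<longleftrightarrow>
     (\<forall>r. (\<forall>P\<in>S. r P \<in> P \<and> r P \<noteq> 0) \<longrightarrow> inj_on r S \<and> vec.independent (r ` S))"

lemma pg_points_iff: "P \<in> pg_points \<longleftrightarrow> (\<exists>u. u \<noteq> 0 \<and> P = vec.span {u})"
  for P :: "('a::field ^ 'n) set"
proof
  assume "P \<in> pg_points"
  then have P: "vec.subspace P" "vec.dim P = 1"
    by (auto simp: pg_points_def)
  obtain B where B: "B \<subseteq> P" "vec.independent B" "P \<subseteq> vec.span B" "card B = vec.dim P"
    using vec.basis_exists by blast
  then obtain u where u: "B = {u}"
    using P(2) by (auto simp: card_1_singleton_iff)
  have "u \<noteq> 0"
    using B(2) u vec.dependent_zero by blast
  moreover have "P = vec.span {u}"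
    using B(1,3) P(1) u vec.span_minimal by blast
  ultimately show "\<exists>u. u \<noteq> 0 \<and> P = vec.span {u}" by blast
next
  assume "\<exists>u. u \<noteq> 0 \<and> P = vec.span {u}"
  then obtain u where u: "u \<noteq> 0" "P = vec.span {u}" by blast
  have "vec.dim P = card {u}"
    using u by (simp only: vec.dim_span_eq_card_independent vec.dependent_single not_False_eq_True)
  then show "P \<in> pg_points"
    using u by (simp add: pg_points_def)
qed

lemma vec_colour_smult:
  fixes u :: "'a::field ^ 'n::{finite,linorder}"
  assumes v: "nonarch_valuation v" and k: "k \<noteq> 0"
  shows "vec_colour v (k *s u) = vec_colour v u"
proof -
  have "v k \<noteq> \<infinity>" "v k \<noteq> -\<infinity>"
    using v k by (auto simp: nonarch_valuation_def vimage_def set_eq_iff)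
  then obtain c where c: "v k = ereal c" by (cases "v k") auto
  have m: "v (k * x) = ereal c + v x" for x
    using v c by (simp add: nonarch_valuation_def)
  have "mono (\<lambda>x. ereal c + x)"
    by (intro monoI add_left_mono)
  then have "Min (range (\<lambda>i. ereal c + v (u $ i))) = ereal c + Min (range (\<lambda>i. v (u $ i)))"
    by (subst mono_Min_commute) (auto simp: image_image)
  then show ?thesis
    by (simp add: vec_colour_def m ereal_add_cancel_left)
qed

lemma point_colour_eq:
  assumes v: "nonarch_valuation v" and P: "P \<in> pg_points" and u: "u \<in> P" "u \<noteq> 0"
  shows "point_colour v P = vec_colour v u"
proof -
  obtain w where w: "w \<noteq> 0" "P = vec.span {w}"
    using P pg_points_iff by blast
  have *: "vec_colour v x = vec_colour v w" if x: "x \<in> P" "x \<noteq> 0" for x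
  proof -
    obtain k where k: "x = k *s w"
      using x(1) w(2) by (auto simp: vec.span_singleton)
    then have "k \<noteq> 0" using x(2) by auto
    then show ?thesis using k v by (simp add: vec_colour_smult)
  qed
  show ?thesis
    unfolding point_colour_def
    using u * by (intro the_equality) metis+
qed

end

theory Submission
  imports Defs
begin

text \<open>
  Suppose finitely many nonzero vectors of pairwise distinct colours sum to zero. Let \<open>m\<close> be the
  smallest valuation of any of their entries, and among the vectors attaining \<open>m\<close> let \<open>u\<close> be the
  one of smallest colour \<open>s\<close>. At coordinate \<open>s\<close> the vector \<open>u\<close> has valuation \<open>m\<close> and every other
  vector has strictly larger valuation, so these entries cannot cancel. A linear
  relation is a vanishing sum of this kind since scaling a vector does not change its colour.
\<close>

text \<open>Since \<open>v\<close> is finite at 1 and -1, cancellation in 1 * 1 = 1 and (-1) * (-1)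
  = 1 gives \<open>v 1 = 0\<close> and then \<open>v (- 1) = 0\<close>.\<close>

lemma nonarch_valuation_uminus:
  assumes "nonarch_valuation v"
  shows "v (- a) = v a"
proof -
  have mult: "v (x * y) = v x + v y" for x y
    using assms by (simp add: nonarch_valuation_def)
  have fin: "v x \<noteq> \<infinity>" "v x \<noteq> -\<infinity>" if "x \<noteq> 0" for x
    using assms that by (auto simp: nonarch_valuation_def vimage_def set_eq_iff)
  obtain c d where c: "v 1 = ereal c" and d: "v (- 1) = ereal d"
    using fin[of 1] fin[of "- 1"] by (cases "v 1"; cases "v (- 1)") auto
  have "c = 0" using mult[of 1 1] c by simp
  then have "d = 0" using mult[of "- 1" "- 1"] c d by simp
  then show ?thesis using mult[of "- 1" a] d by simp
qed

lemma nonarch_valuation_sum_greater: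
  assumes v: "nonarch_valuation v" and "finite A" and "m < \<infinity>"
    and "\<And>x. x \<in> A \<Longrightarrow> m < v (f x)"
  shows "m < v (sum f A)"
  using assms(2,4)
proof (induction A rule: finite_induct)
  case empty
  \<comment> \<open>The empty sum is where \<open>m < \<infinity>\<close> enters; it arises below
    when the family has a single member.\<close>
  have "v 0 = \<infinity>" using v by (auto simp: nonarch_valuation_def)
  then show ?case using \<open>m < \<infinity>\<close> by simp
next
  case (insert x A)
  then have "m < min (v (f x)) (v (sum f A))" by simp
  also have "\<dots> \<le> v (f x + sum f A)" using v by (simp add: nonarch_valuation_def)
  finally show ?case using insert by simp
qed

text \<open>The class \<open>linorder\<close> alone gives no well-ordering for \<open>LEAST\<close>.
  The minimising indices form a finite nonempty set \<open>X\<close>, so the colour equals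
  \<open>Min X\<close>.\<close>

lemma vec_colour_attains:
  "v (u $ vec_colour v u) = Min (range (\<lambda>i. v (u $ i)))" (is ?attains)
  and vec_colour_least:
  "v (u $ i) = Min (range (\<lambda>i. v (u $ i))) \<Longrightarrow> vec_colour v u \<le> i"
proof -
  define X where "X = {s. v (u $ s) = Min (range (\<lambda>i. v (u $ i)))}"
  have "Min (range (\<lambda>i. v (u $ i))) \<in> range (\<lambda>i. v (u $ i))"
    by (intro Min_in) auto
  then have X: "finite X" "X \<noteq> {}" by (auto simp: X_def image_iff eq_commute)
  have colour: "vec_colour v u = Min X"
    unfolding vec_colour_def
    using Min_in[OF X] Min_le[OF X(1)] by (intro Least_equality) (auto simp: X_def)
  show ?attains using Min_in[OF X] colour by (simp add: X_def)
  show "vec_colour v u \<le> i" if "v (u $ i) = Min (range (\<lambda>i. v (u $ i)))"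
    using that Min_le[OF X(1), of i] colour by (simp add: X_def)
qed

lemma vec_colour_le: "v (u $ vec_colour v u) \<le> v (u $ i)"
  unfolding vec_colour_attains by simp

lemma vec_colour_less:
  assumes "i < vec_colour v u"
  shows "v (u $ vec_colour v u) < v (u $ i)"
proof -
  have "v (u $ i) \<noteq> v (u $ vec_colour v u)"
    using assms vec_colour_least[of v u i] by (auto simp: vec_colour_attains)
  then show ?thesis using vec_colour_le[of v u i] by simp
qed

text \<open>Stated for an indexed family so that it applies directly to the terms
  \<open>c w *s w\<close> of a linear relation.\<close>

lemma sum_distinct_colours_nonzero:
  fixes f :: "'b \<Rightarrow> 'a::field ^ 'n::{finite,linorder}"
  assumes v: "nonarch_valuation v" and T: "finite T" "T \<noteq> {}"
    and nz: "\<And>t. t \<in> T \<Longrightarrow> f t \<noteq> 0"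
    and inj: "inj_on (\<lambda>t. vec_colour v (f t)) T"
  shows "sum f T \<noteq> 0"
proof
  assume zero: "sum f T = 0"
  define col where "col t = vec_colour v (f t)" for t
  define \<mu> where "\<mu> t = v (f t $ col t)" for t
  define m where "m = Min (\<mu> ` T)"
  define A where "A = {t \<in> T. \<mu> t = m}"
  have m_le: "m \<le> \<mu> t" if "t \<in> T" for t
    using T that by (simp add: m_def)
  have "m \<in> \<mu> ` T" unfolding m_def using T by (intro Min_in) auto
  then have A: "finite A" "A \<noteq> {}" using T by (auto simp: A_def)
  have "Min (col ` A) \<in> col ` A" using A by (intro Min_in) auto
  then obtain t0 where t0: "t0 \<in> A" "col t0 = Min (col ` A)" by auto
  have t0T: "t0 \<in> T" "\<mu> t0 = m" using t0 by (auto simp: A_def)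
  have fin: "m < \<infinity>"
  proof -
    obtain i where "f t0 $ i \<noteq> 0" using nz[OF t0T(1)] by (auto simp: vec_eq_iff)
    then have "v (f t0 $ i) \<noteq> \<infinity>"
      using v by (auto simp: nonarch_valuation_def vimage_def set_eq_iff)
    then show ?thesis
      using vec_colour_le[of v "f t0" i] t0T by (auto simp: \<mu>_def col_def less_top)
  qed
  have others: "m < v (f t $ col t0)" if t: "t \<in> T - {t0}" for t
  \<comment> \<open>If \<open>t\<close> attains \<open>m\<close>, its colour lies strictly above
    \<open>col t0\<close>, so its entry at \<open>col t0\<close> comes before its first minimal
    entry. Otherwise all its entries exceed \<open>m\<close>.\<close>
  proof (cases "\<mu> t = m")
    case True
    then have "t \<in> A" using t by (simp add: A_def)
    then have "col t0 \<le> col t" using A t0 by simp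
    moreover have "col t0 \<noteq> col t" using inj t t0T by (auto simp: inj_on_def col_def)
    ultimately show ?thesis
      using vec_colour_less[of "col t0" v "f t"] True by (simp add: \<mu>_def col_def)
  next
    case False
    then have "m < \<mu> t" using m_le[of t] t by simp
    also have "\<dots> \<le> v (f t $ col t0)" by (simp add: \<mu>_def col_def vec_colour_le)
    finally show ?thesis .
  qed
  have "m < v (\<Sum>t\<in>T - {t0}. f t $ col t0)"
    using T fin others by (intro nonarch_valuation_sum_greater[OF v]) auto
  \<comment> \<open>Reading the vanishing sum at coordinate \<open>col t0\<close> gives an entry of
    valuation exactly \<open>m\<close> the valuation of the remaining sum, which is larger.\<close>
  moreover have "f t0 $ col t0 = - (\<Sum>t\<in>T - {t0}. f t $ col t0)"
  proof -
    have "f t0 $ col t0 + (\<Sum>t\<in>T - {t0}. f t $ col t0) = (sum f T) $ col t0"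
      using T t0T by (simp add: sum.remove)
    then show ?thesis using zero by (simp add: eq_neg_iff_add_eq_0)
  qed
  ultimately have "m < \<mu> t0" by (simp add: \<mu>_def nonarch_valuation_uminus[OF v])
  then show False using t0T by simp
qed

lemma distinct_colours_independent:
  fixes B :: "('a::field ^ 'n::{finite,linorder}) set"
  assumes v: "nonarch_valuation v" and "0 \<notin> B" and inj: "inj_on (vec_colour v) B"
  shows "vec.independent B"
proof
  assume "vec.dependent B"
  then obtain T c where T: "finite T" "T \<subseteq> B" "(\<Sum>w\<in>T. c w *s w) = 0" "\<exists>w\<in>T. c w \<noteq> 0"
    unfolding vec.dependent_explicit by blast
  \<comment> \<open>Terms with coefficient 0 are dropped: the remaining ones are nonzero, and
    scaling by a nonzero coefficient preserves the colour.\<close>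
  define T' where "T' = {w \<in> T. c w \<noteq> 0}"
  have "(\<Sum>w\<in>T'. c w *s w) = (\<Sum>w\<in>T. c w *s w)"
    using T(1) by (intro sum.mono_neutral_left) (auto simp: T'_def)
  moreover have "(\<Sum>w\<in>T'. c w *s w) \<noteq> 0"
  proof (rule sum_distinct_colours_nonzero[OF v])
    show "finite T'" "T' \<noteq> {}" using T by (auto simp: T'_def)
    show "c w *s w \<noteq> 0" if "w \<in> T'" for w
      using that T(2) \<open>0 \<notin> B\<close> by (auto simp: T'_def)
    have "vec_colour v (c w *s w) = vec_colour v w" if "w \<in> T'" for w
      using that v by (simp add: T'_def vec_colour_smult)
    moreover have "inj_on (vec_colour v) T'"
      using inj T(2) by (auto simp: T'_def intro: inj_on_subset)
    ultimately show "inj_on (\<lambda>w. vec_colour v (c w *s w)) T'"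
      by (simp cong: inj_on_cong)
  qed
  ultimately show False using T(3) by simp
qed

theorem theorem12p1:
  fixes v :: "'a::field \<Rightarrow> ereal"
    and S :: "('a ^ 'n::{finite,linorder}) set set"
  assumes "nonarch_valuation v"
    and "S \<subseteq> pg_points"
    and "rainbow v S"
  shows "independent_points S"
  unfolding independent_points_def
proof (intro allI impI)
  fix r
  assume r: "\<forall>P\<in>S. r P \<in> P \<and> r P \<noteq> 0"
  have "vec_colour v (r P) = point_colour v P" if "P \<in> S" for P
    using that r assms(1,2) point_colour_eq[of v P "r P"] by auto
  then have "inj_on (\<lambda>P. vec_colour v (r P)) S"
    using assms(3) by (simp add: rainbow_def cong: inj_on_cong)
  then have inj: "inj_on (vec_colour v \<circ> r) S" by (simp add: comp_def)
  have "vec.independent (r ` S)"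
    using r inj_on_imageI[OF inj]
    by (intro distinct_colours_independent[OF assms(1)]) auto
  then show "inj_on r S \<and> vec.independent (r ` S)"
    using inj_on_imageI2[OF inj] by blast
qed

end
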